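(* Let $p$ be an odd prime and let $k\ge 2$ be an even integer dividing $p-1$; write $p=km+1$. Suppose that $-1$ is not a $k$-th power residue modulo $p$. Let $0<\alpha_1<\cdots<\alpha_m<p$ be all the $k$-th power residues modulo $p$ in $(0,p)$ and let $$I_p(k)=\left[\frac{1}{\alpha_i+\alpha_j}\right]_{1\le i,j\le m}.$$ Then $$\det I_p(k)\equiv \frac{(-1)^{\frac{m+1}{2}}}{(2k)^m}\pmod p.$$
   Context: An integer $\alpha$ with $p\nmid\alpha$ is a $k$-th power residue modulo $p$ if $\alpha\equiv x^k\pmod p$ for some integer $x$. Here $\det I_p(k)$ is a rational number whose denominator is prime to $p$, and congruences modulo $p$ between such rational numbers are understood in the ring of rationals with denominator prime to $p$. *)

theory Defs
  imports "HOL-Number_Theory.Cong" "HOL-Computational_Algebra.Primes" "Jordan_Normal_Form.Determinant"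
begin

definition power_residue :: "nat \<Rightarrow> nat \<Rightarrow> int \<Rightarrow> bool" where
  "power_residue p k a \<longleftrightarrow> \<not> int p dvd a \<and> (\<exists>x :: int. [a = x ^ k] (mod int p))"

text \<open>The ring of rationals whose denominator (in lowest terms) is prime to \<open>p\<close>.\<close>

definition rat_integers_at :: "nat \<Rightarrow> rat set" where
  "rat_integers_at p = {r. coprime (snd (quotient_of r)) (int p)}"

text \<open>Congruence modulo the ideal generated by \<open>p\<close> in that ring. Membership of both
  sides in the ring is part of the relation.\<close>

definition rat_cong :: "nat \<Rightarrow> rat \<Rightarrow> rat \<Rightarrow> bool" where
  "rat_cong p r s \<longleftrightarrow> r \<in> rat_integers_at p \<and> s \<in> rat_integers_at p \<and>
     (\<exists>t \<in> rat_integers_at p. r - s = of_nat p * t)"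

text \<open>Matrices of type \<open>'a mat\<close> are indexed from \<open>0\<close>, while the sequence \<open>\<alpha>\<close> is indexed from \<open>1\<close>.\<close>

definition I_mat :: "nat \<Rightarrow> (nat \<Rightarrow> int) \<Rightarrow> rat mat" where
  "I_mat m \<alpha> = mat m m (\<lambda>(i, j). 1 / (of_int (\<alpha> (i + 1)) + of_int (\<alpha> (j + 1))))"

end

theory Submission
  imports Defs "HOL-Number_Theory.Residue_Primitive_Roots"
begin

text \<open>Modulo \<open>p\<close> the residues \<open>\<alpha>\<^sub>i\<close> are the \<open>m\<close>-th roots of unity, and \<open>m\<close> is odd because
  \<open>-1\<close> is not among them. From \<open>a\<^sup>m + b\<^sup>m = 2\<close> one gets
  \<open>2 / (a + b) = (\<Sum>l<m. (-1)\<^sup>l a\<^bsup>m-1-l\<^esup> b\<^sup>l)\<close>, so the matrix \<open>2 I\<^sub>p(k)\<close> factors as \<open>A D V\<close>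
  with \<open>A\<^sub>i\<^sub>l = \<alpha>\<^sub>i\<^bsup>m-1-l\<^esup>\<close>, \<open>D = diag((-1)\<^sup>l)\<close> and \<open>V\<^sub>l\<^sub>j = \<alpha>\<^sub>j\<^sup>l\<close>. Dropping the signs, \<open>A V\<close> is
  diagonal with entries \<open>m \<alpha>\<^sub>i\<^bsup>m-1\<^esup>\<close>, since its off-diagonal entries are
  \<open>(\<alpha>\<^sub>i\<^sup>m - \<alpha>\<^sub>j\<^sup>m) / (\<alpha>\<^sub>i - \<alpha>\<^sub>j) = 0\<close>. Hence no Vandermonde or Cauchy determinant has to be
  evaluated. The product of the \<open>\<alpha>\<^sub>i\<close> squares to \<open>1\<close> (invert every factor), and
  \<open>k m = -1\<close> turns \<open>m\<^sup>m\<close> into \<open>-1 / k\<^sup>m\<close>.\<close>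

section \<open>Congruence of rationals\<close>

text \<open>Closure under sums and products is easier to check on unreduced fractions. The reduced
  denominator \<open>d\<close> divides every other denominator \<open>b\<close>, because
  \<open>c * b = a * d\<close> with \<open>c\<close> and \<open>d\<close> coprime.\<close>

lemma rat_integers_at_iff:
  "r \<in> rat_integers_at p \<longleftrightarrow>
    (\<exists>a b. b \<noteq> 0 \<and> coprime b (int p) \<and> r = of_int a / of_int b)"
proof
  obtain c d where q: "quotient_of r = (c, d)" by force
  have d: "d > 0" and cd: "coprime c d" and r: "r = of_int c / of_int d"
    using q quotient_of_denom_pos quotient_of_coprime quotient_of_div by blast+
  {
    assume "r \<in> rat_integers_at p"
    thus "\<exists>a b. b \<noteq> 0 \<and> coprime b (int p) \<and> r = of_int a / of_int b"
      using q d r by (intro exI[of _ c] exI[of _ d]) (simp add: rat_integers_at_def)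
  next
    assume "\<exists>a b. b \<noteq> 0 \<and> coprime b (int p) \<and> r = of_int a / of_int b"
    then obtain a b where b: "b \<noteq> 0" "coprime b (int p)" and ab: "r = of_int a / of_int b"
      by blast
    have "(of_int (c * b) :: rat) = of_int (a * d)"
      using r ab b d by (simp add: field_simps)
    hence "c * b = a * d" by (simp only: of_int_eq_iff)
    hence "d dvd b"
      using cd by (metis coprime_commute coprime_dvd_mult_right_iff dvd_triv_right)
    from coprime_divisors[OF this dvd_refl b(2)] have "coprime d (int p)" .
    thus "r \<in> rat_integers_at p" using q by (simp add: rat_integers_at_def)
  }
qed

lemma of_int_in_rat_integers_at [simp]: "of_int a \<in> rat_integers_at p"
  unfolding rat_integers_at_iff by (intro exI[of _ a] exI[of _ "1 :: int"]) simp

lemma of_int_divide_in_rat_integers_at: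
  "b \<noteq> 0 \<Longrightarrow> coprime b (int p) \<Longrightarrow> of_int a / of_int b \<in> rat_integers_at p"
  unfolding rat_integers_at_iff by blast

lemma rat_integers_at_add:
  assumes "r \<in> rat_integers_at p" "s \<in> rat_integers_at p"
  shows "r + s \<in> rat_integers_at p"
proof -
  obtain a b c d where
    "b \<noteq> 0" "coprime b (int p)" "r = of_int a / of_int b"
    "d \<noteq> 0" "coprime d (int p)" "s = of_int c / of_int d"
    using assms unfolding rat_integers_at_iff by blast
  thus ?thesis unfolding rat_integers_at_iff
    by (intro exI[of _ "a * d + c * b"] exI[of _ "b * d"]) (simp add: add_frac_eq)
qed

lemma rat_integers_at_mult:
  assumes "r \<in> rat_integers_at p" "s \<in> rat_integers_at p"
  shows "r * s \<in> rat_integers_at p"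
proof -
  obtain a b c d where
    "b \<noteq> 0" "coprime b (int p)" "r = of_int a / of_int b"
    "d \<noteq> 0" "coprime d (int p)" "s = of_int c / of_int d"
    using assms unfolding rat_integers_at_iff by blast
  thus ?thesis unfolding rat_integers_at_iff
    by (intro exI[of _ "a * c"] exI[of _ "b * d"]) simp
qed

lemma rat_integers_at_uminus: "r \<in> rat_integers_at p \<Longrightarrow> - r \<in> rat_integers_at p"
  using rat_integers_at_mult[OF of_int_in_rat_integers_at[of "- 1"], of r p] by simp

lemma rat_cong_refl: "r \<in> rat_integers_at p \<Longrightarrow> rat_cong p r r"
  unfolding rat_cong_def using of_int_in_rat_integers_at[of 0 p] by force

lemma rat_cong_trans [trans]:
  assumes "rat_cong p r s" "rat_cong p s t" shows "rat_cong p r t"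
proof -
  obtain u v where uv: "u \<in> rat_integers_at p" "v \<in> rat_integers_at p"
    "r - s = of_nat p * u" "s - t = of_nat p * v"
    using assms unfolding rat_cong_def by blast
  have "r - t = of_nat p * (u + v)" using uv(3,4) by (simp add: algebra_simps)
  thus ?thesis using assms uv rat_integers_at_add unfolding rat_cong_def by blast
qed

lemma rat_cong_sym: "rat_cong p r s \<Longrightarrow> rat_cong p s r"
proof -
  assume rs: "rat_cong p r s"
  then obtain u where u: "u \<in> rat_integers_at p" "r - s = of_nat p * u"
    unfolding rat_cong_def by blast
  have "s - r = of_nat p * (- u)" using u(2) by (simp add: algebra_simps)
  thus ?thesis using rs u rat_integers_at_uminus unfolding rat_cong_def by blast
qed

lemma rat_cong_add:
  assumes "rat_cong p r s" "rat_cong p t u" shows "rat_cong p (r + t) (s + u)"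
proof -
  obtain x y where xy: "x \<in> rat_integers_at p" "y \<in> rat_integers_at p"
    "r - s = of_nat p * x" "t - u = of_nat p * y"
    using assms unfolding rat_cong_def by blast
  have "r + t - (s + u) = of_nat p * (x + y)" using xy(3,4) by (simp add: algebra_simps)
  thus ?thesis using assms xy rat_integers_at_add unfolding rat_cong_def by blast
qed

lemma rat_cong_mult:
  assumes "rat_cong p r s" "rat_cong p t u" shows "rat_cong p (r * t) (s * u)"
proof -
  obtain x y where xy: "x \<in> rat_integers_at p" "y \<in> rat_integers_at p"
    "r - s = of_nat p * x" "t - u = of_nat p * y"
    using assms unfolding rat_cong_def by blast
  have "r * t - s * u = (r - s) * t + s * (t - u)" by (simp add: algebra_simps)
  also have "\<dots> = of_nat p * (x * t + s * y)" unfolding xy(3,4) by (simp add: algebra_simps)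
  finally have "r * t - s * u = of_nat p * (x * t + s * y)" .
  thus ?thesis using assms xy rat_integers_at_add rat_integers_at_mult
    unfolding rat_cong_def by blast
qed

lemma rat_cong_of_int:
  assumes "[a = b] (mod int p)" shows "rat_cong p (of_int a) (of_int b)"
proof -
  obtain c where "a - b = int p * c" using assms by (auto simp: cong_iff_dvd_diff)
  hence "(of_int a :: rat) - of_int b = of_nat p * of_int c"
    by (metis of_int_diff of_int_mult of_int_of_nat_eq)
  thus ?thesis unfolding rat_cong_def by auto
qed

lemma rat_cong_sum:
  "(\<And>x. x \<in> A \<Longrightarrow> rat_cong p (f x) (g x)) \<Longrightarrow> rat_cong p (sum f A) (sum g A)"
  \<comment> \<open>The congruence of 0 with itself serves the empty and the infinite
    \<open>A\<close>, where both sums are 0.\<close>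
  using rat_cong_of_int[of 0 0 p]
  by (induction A rule: infinite_finite_induct) (auto intro: rat_cong_add)

lemma rat_cong_prod:
  "(\<And>x. x \<in> A \<Longrightarrow> rat_cong p (f x) (g x)) \<Longrightarrow> rat_cong p (prod f A) (prod g A)"
  using rat_cong_of_int[of 1 1 p]
  by (induction A rule: infinite_finite_induct) (auto intro: rat_cong_mult)

text \<open>By the Leibniz formula a determinant is a polynomial with integer coefficients in the
  entries.\<close>

lemma rat_cong_det:
  assumes "A \<in> carrier_mat n n" "B \<in> carrier_mat n n"
    and "\<And>i j. i < n \<Longrightarrow> j < n \<Longrightarrow> rat_cong p (A $$ (i, j)) (B $$ (i, j))"
  shows "rat_cong p (det A) (det B)"
proof -
  have "rat_cong p (signof \<pi>) (signof \<pi>)" for \<pi> :: "nat \<Rightarrow> nat"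
    using rat_cong_of_int[of "signof \<pi>" "signof \<pi>" p] by (auto simp: sign_def)
  thus ?thesis unfolding det_def'[OF assms(1)] det_def'[OF assms(2)]
    using assms(3) by (auto intro!: rat_cong_sum rat_cong_mult rat_cong_prod)
qed

text \<open>Multiply by 1/c, which lies in the ring. This reduces fractions to integers, both for
  single entries and for the final division by \<open>(2 * k) ^ m\<close>.\<close>

lemma rat_cong_divide_of_int:
  assumes "c \<noteq> 0" "coprime c (int p)" "rat_cong p (of_int c * r) s"
  shows "rat_cong p r (s / of_int c)"
proof -
  have "rat_cong p (of_int 1 / of_int c) (of_int 1 / of_int c)"
    using assms(1,2) by (intro rat_cong_refl of_int_divide_in_rat_integers_at)
  from rat_cong_mult[OF this assms(3)] show ?thesis using assms(1) by simp
qed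

section \<open>Matrices built from roots of unity\<close>

lemma det_mat_diag: "det (mat n n (\<lambda>(i, j). if i = j then f i else 0)) = (\<Prod>i<n. f i)"
proof -
  have "det (mat n n (\<lambda>(i, j). if i = j then f i else 0)) =
      prod_list (diag_mat (mat n n (\<lambda>(i, j). if i = j then f i else 0)))"
    by (rule det_upper_triangular[where n = n]) (auto simp: upper_triangular_def)
  also have "\<dots> = (\<Prod>i<n. f i)"
    unfolding prod_list_diag_prod by (auto simp: atLeast0LessThan intro!: prod.cong)
  finally show ?thesis .
qed

text \<open>Passing from \<open>n\<close> to \<open>n + 1\<close> adds the exponents 2n+1 and 2n+2,
  hence one factor -1. This evaluates \<open>det D\<close> below.\<close>

lemma prod_minus_one_power: "(\<Prod>l<2 * n + 1. (- 1) ^ l) = ((- 1) ^ n :: 'a :: comm_ring_1)"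
  by (induction n) auto

text \<open>Used with \<open>y = - b\<close> and odd \<open>m\<close> for the entries of
  \<open>A * (D * V)\<close>, and with \<open>y = b\<close> for those of
  \<open>A * V\<close>.\<close>

lemma power_diff_eq_mult_sum:
  fixes x y :: "'a :: comm_ring_1"
  shows "x ^ m - y ^ m = (x - y) * (\<Sum>l<m. x ^ (m - 1 - l) * y ^ l)"
proof (cases m)
  case (Suc n)
  have "y ^ m - x ^ m = (y - x) * (\<Sum>l<m. y ^ l * x ^ (n - l))"
    unfolding Suc by (rule diff_power_eq_sum)
  thus ?thesis using Suc by (simp add: algebra_simps)
qed simp

text \<open>The prime \<open>p\<close> divides \<open>a ^ m - b ^ m\<close>, which is
  \<open>a - b\<close> times the sum, but it does not divide \<open>a - b\<close>.\<close>

lemma sum_roots_of_unity_cong: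
  fixes a b :: int
  assumes "prime p" "[a ^ m = 1] (mod int p)" "[b ^ m = 1] (mod int p)"
    and "\<not> [a = b] (mod int p)"
  shows "[(\<Sum>l<m. a ^ (m - 1 - l) * b ^ l) = 0] (mod int p)"
proof -
  have "int p dvd a ^ m - b ^ m"
    using assms(2,3) by (metis cong_iff_dvd_diff cong_sym cong_trans)
  hence "int p dvd (a - b) * (\<Sum>l<m. a ^ (m - 1 - l) * b ^ l)"
    by (simp only: power_diff_eq_mult_sum)
  thus ?thesis using assms(1,4) by (simp add: prime_dvd_mult_iff cong_iff_dvd_diff)
qed

text \<open>On the right the sign is \<open>det D\<close>, and the rest is the product of the
  diagonal entries of \<open>E\<close>, to which \<open>A * V\<close> reduces modulo
  \<open>p\<close>. The factor \<open>2 ^ m\<close> comes from doubling the matrix.\<close>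

lemma rat_cong_det_inverse_sum_roots_of_unity:
  fixes a :: "nat \<Rightarrow> int"
  assumes p: "prime p" "odd p" and "odd m"
    and root: "\<And>i. i < m \<Longrightarrow> [a i ^ m = 1] (mod int p)"
    and inj: "\<And>i j. i < m \<Longrightarrow> j < m \<Longrightarrow> [a i = a j] (mod int p) \<Longrightarrow> i = j"
  shows "rat_cong p (2 ^ m * det (mat m m (\<lambda>(i, j). 1 / (of_int (a i) + of_int (a j)))))
    (of_int ((- 1) ^ (m div 2) * int m ^ m * (\<Prod>i<m. a i) ^ (m - 1)))"
proof -
  define M :: "rat mat" where "M = mat m m (\<lambda>(i, j). 1 / (of_int (a i) + of_int (a j)))"
  define A :: "rat mat" where "A = mat m m (\<lambda>(i, l). of_int (a i ^ (m - 1 - l)))"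
  define D :: "rat mat" where "D = mat m m (\<lambda>(i, j). if i = j then (- 1) ^ i else 0)"
  define V :: "rat mat" where "V = mat m m (\<lambda>(l, j). of_int (a j ^ l))"
  define E :: "rat mat" where
    "E = mat m m (\<lambda>(i, j). if i = j then of_int (int m * a i ^ (m - 1)) else 0)"
  have carrier [simp]: "M \<in> carrier_mat m m" "A \<in> carrier_mat m m" "D \<in> carrier_mat m m"
    "V \<in> carrier_mat m m" "E \<in> carrier_mat m m"
    by (simp_all add: M_def A_def D_def V_def E_def)
  \<comment> \<open>The signs are absorbed into the base, so that \<open>A * (D * V)\<close> has the
    entries of \<open>A * V\<close> with \<open>a j\<close> replaced by
    \<open>- a j\<close>.\<close>
  have DV: "D * V = mat m m (\<lambda>(l, j). of_int ((- a j) ^ l))"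
  proof (rule eq_matI)
    fix l j assume "l < dim_row (mat m m (\<lambda>(l, j). of_int ((- a j) ^ l)) :: rat mat)"
      and "j < dim_col (mat m m (\<lambda>(l, j). of_int ((- a j) ^ l)) :: rat mat)"
    hence lj: "l < m" "j < m" by auto
    have "(D * V) $$ (l, j) =
        (\<Sum>i<m. (if l = i then (- 1) ^ l else 0) * of_int (a j ^ i))"
      using lj by (auto simp: D_def V_def scalar_prod_def atLeast0LessThan intro!: sum.cong)
    also have "\<dots> = (\<Sum>i<m. if l = i then (- 1) ^ l * of_int (a j ^ i) else 0)"
      by (intro sum.cong) auto
    also have "\<dots> = of_int ((- a j) ^ l)"
      using lj by (simp add: power_minus[of "of_int (a j)" l])
    finally show "(D * V) $$ (l, j) = mat m m (\<lambda>(l, j). of_int ((- a j) ^ l)) $$ (l, j)"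
      using lj by simp
  qed (auto simp: D_def V_def)
  have ADV: "(A * (D * V)) $$ (i, j) = of_int (\<Sum>l<m. a i ^ (m - 1 - l) * (- a j) ^ l)"
    if "i < m" "j < m" for i j
    using that unfolding DV
    by (auto simp: A_def scalar_prod_def atLeast0LessThan intro!: sum.cong)
  have AV: "(A * V) $$ (i, j) = of_int (\<Sum>l<m. a i ^ (m - 1 - l) * a j ^ l)"
    if "i < m" "j < m" for i j
    using that by (auto simp: A_def V_def scalar_prod_def atLeast0LessThan intro!: sum.cong)

  have "rat_cong p (det (A * (D * V))) (det (2 \<cdot>\<^sub>m M))"
  proof (rule rat_cong_det[where n = m])
    fix i j assume ij: "i < m" "j < m"
    define c where "c = a i + a j"
    define S where "S = (\<Sum>l<m. a i ^ (m - 1 - l) * (- a j) ^ l)"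
    have "c * S = a i ^ m + a j ^ m"
      using power_diff_eq_mult_sum[of "a i" m "- a j"] \<open>odd m\<close> by (simp add: c_def S_def)
    moreover have "[a i ^ m + a j ^ m = 1 + 1] (mod int p)"
      using ij by (intro cong_add root)
    ultimately have cS: "[c * S = 2] (mod int p)" by simp
    \<comment> \<open>Since \<open>c * S\<close> is congruent to 2, a unit modulo the odd prime
      \<open>p\<close>, the denominator \<open>c\<close> is prime to \<open>p\<close>.\<close>
    have "\<not> int p dvd 2"
      using p by (metis dvd_refl even_of_nat int_dvd_int_iff of_nat_numeral primes_dvd_imp_eq
          two_is_prime_nat)
    hence "\<not> int p dvd c" using cS by (metis cong_dvd_iff dvd_mult2)
    hence c: "c \<noteq> 0" "coprime c (int p)"
      using p(1) prime_imp_coprime[of "int p" c] by (auto simp: coprime_commute)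
    have "rat_cong p (of_int c * of_int S) (of_int 2)"
      using rat_cong_of_int[OF cS] by simp
    from rat_cong_divide_of_int[OF c this]
    show "rat_cong p ((A * (D * V)) $$ (i, j)) ((2 \<cdot>\<^sub>m M) $$ (i, j))"
      using ij by (simp add: ADV M_def S_def c_def)
  qed (use carrier in \<open>blast intro: smult_carrier_mat mult_carrier_mat\<close>)+
  hence "rat_cong p (2 ^ m * det M) (det (A * (D * V)))"
    using rat_cong_sym by (simp add: M_def)
  \<comment> \<open>Determinants commute, so \<open>D\<close> can be pulled out from between
    \<open>A\<close> and \<open>V\<close>.\<close>
  also have "det (A * (D * V)) = det D * det (A * V)"
    by (simp add: det_mult[of _ m] mult_carrier_mat[of _ m m] mult_ac)
  also have "det D = (- 1) ^ (m div 2)"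
    using \<open>odd m\<close> prod_minus_one_power[of "m div 2", where 'a = rat]
    by (simp add: D_def det_mat_diag)
  also have "rat_cong p ((- 1) ^ (m div 2) * det (A * V)) ((- 1) ^ (m div 2) * det E)"
  proof (rule rat_cong_mult)
    show "rat_cong p ((- 1) ^ (m div 2)) ((- 1) ^ (m div 2))"
      using rat_cong_of_int[of "(- 1) ^ (m div 2)" "(- 1) ^ (m div 2)" p] by simp
    show "rat_cong p (det (A * V)) (det E)"
    proof (rule rat_cong_det[where n = m])
      fix i j assume ij: "i < m" "j < m"
      show "rat_cong p ((A * V) $$ (i, j)) (E $$ (i, j))"
      proof (cases "i = j")
        case True
        have "(\<Sum>l<m. a i ^ (m - 1 - l) * a i ^ l) = (\<Sum>l<m. a i ^ (m - 1))"
          by (intro sum.cong) (auto simp flip: power_add)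
        hence "(\<Sum>l<m. a i ^ (m - 1 - l) * a j ^ l) = int m * a i ^ (m - 1)"
          using True by simp
        hence "(A * V) $$ (i, j) = of_int (int m * a i ^ (m - 1))"
          unfolding AV[OF ij] by (simp only:)
        moreover have "E $$ (i, j) = of_int (int m * a i ^ (m - 1))"
          using ij True by (simp add: E_def)
        ultimately show ?thesis
          by (simp only: rat_cong_refl[OF of_int_in_rat_integers_at])
      next
        case False
        hence "[(\<Sum>l<m. a i ^ (m - 1 - l) * a j ^ l) = 0] (mod int p)"
          using ij p(1) inj by (intro sum_roots_of_unity_cong root) auto
        from rat_cong_of_int[OF this] show ?thesis
          using ij False unfolding AV[OF ij] by (simp add: E_def)
      qed
    qed (use carrier in \<open>blast intro: mult_carrier_mat\<close>)+
  qed
  also have "det E = of_int (int m ^ m * (\<Prod>i<m. a i) ^ (m - 1))"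
    unfolding E_def det_mat_diag by (simp add: prod.distrib flip: prod_power_distrib)
  finally show ?thesis by (simp add: M_def mult.assoc)
qed

section \<open>Power residues modulo a prime\<close>

text \<open>The theorem for natural numbers is applied to the representative
  \<open>x mod int p\<close>.\<close>

lemma fermat_theorem_int:
  assumes "prime p" "\<not> int p dvd x"
  shows "[x ^ (p - 1) = 1] (mod int p)"
proof -
  have x: "[int (nat (x mod int p)) = x] (mod int p)"
    using assms(1) prime_gt_0_nat by (simp add: cong_def)
  hence "\<not> p dvd nat (x mod int p)"
    using assms(2) by (metis cong_dvd_iff int_dvd_int_iff)
  from fermat_theorem[OF assms(1) this]
  have "[int (nat (x mod int p)) ^ (p - 1) = 1] (mod int p)"
    by (metis cong_int_iff of_nat_1 of_nat_power)
  thus ?thesis using x by (metis cong_pow cong_sym cong_trans)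
qed

lemma power_residue_power_cong_1:
  assumes "prime p" "p = k * m + 1" "power_residue p k a"
  shows "[a ^ m = 1] (mod int p)"
proof -
  obtain x where x: "[a = x ^ k] (mod int p)" and a: "\<not> int p dvd a"
    using assms(3) by (auto simp: power_residue_def)
  \<comment> \<open>For \<open>k = 0\<close> one would have \<open>p = 1\<close>. With
    \<open>k > 0\<close>, \<open>p\<close> dividing \<open>x\<close> would force it to divide
    \<open>a\<close>.\<close>
  have "k > 0" using assms(1,2) by (cases k) auto
  hence "\<not> int p dvd x" using x a by (metis cong_dvd_iff dvd_power dvd_trans)
  from fermat_theorem_int[OF assms(1) this] have "[x ^ (k * m) = 1] (mod int p)"
    using assms(2) by simp
  thus ?thesis using cong_pow[OF x, of m] by (metis cong_trans power_mult)
qed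

text \<open>For a primitive root \<open>g\<close> and \<open>h = (p - 1) div 2\<close>, the power
  \<open>g ^ h\<close> is a square root of 1 other than 1, hence -1. For even \<open>m\<close>,
  \<open>k\<close> divides \<open>h\<close>. The contrapositive makes \<open>m\<close> odd in the
  theorem.\<close>

lemma power_residue_minus_one:
  assumes "prime p" "odd p" "p = k * m + 1" "even m"
  shows "power_residue p k (- 1)"
proof -
  have p2: "p > 2" using assms(1,2) by (metis even_numeral nat_less_le prime_ge_2_nat)
  define h where "h = (p - 1) div 2"
  have h: "p - 1 = 2 * h" "h > 0" using assms(2) p2 by (auto simp: h_def)
  have hk: "h = m div 2 * k" using assms(3,4) by (auto simp: h_def)
  obtain g where "residue_primroot p g"
    using prime_primitive_root_exists[of p] assms(1) p2 by auto
  hence g: "coprime p g" "ord p g = p - 1"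
    using assms(1) by (auto simp: residue_primroot_def totient_prime)
  have "\<not> ord p g dvd h" using g(2) h by (auto dest: dvd_imp_le)
  hence "\<not> [g ^ h = 1] (mod p)" unfolding ord_divides .
  hence n1: "\<not> [int g ^ h = 1] (mod int p)"
    by (metis cong_int_iff of_nat_1 of_nat_power)
  have "[g ^ (2 * h) = 1] (mod p)" unfolding ord_divides using g(2) h(1) by simp
  hence "[int g ^ (2 * h) = 1] (mod int p)"
    by (metis cong_int_iff of_nat_1 of_nat_power)
  hence "int p dvd (int g ^ h - 1) * (int g ^ h + 1)"
    by (simp add: cong_iff_dvd_diff power_mult power_mult_distrib algebra_simps power2_eq_square
        mult.commute[of 2])
  hence "int p dvd int g ^ h + 1"
    using n1 assms(1) by (simp add: prime_dvd_mult_iff cong_iff_dvd_diff)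
  hence "[- 1 = (int g ^ (m div 2)) ^ k] (mod int p)"
    by (subst cong_sym_eq) (simp add: cong_iff_dvd_diff hk power_mult)
  moreover have "\<not> int p dvd - 1" using p2 by simp
  ultimately show ?thesis unfolding power_residue_def by blast
qed

lemma prod_power_residues_square_cong:
  fixes S :: "int set"
  assumes "prime p" "p = k * m + 1"
    and S: "S = {a. 0 < a \<and> a < int p \<and> power_residue p k a}"
  shows "[(\<Prod>S) ^ 2 = 1] (mod int p)"
proof -
  have p0: "int p > 0" using assms(1) by (simp add: prime_gt_0_nat)
  have m0: "m > 0" using assms(1,2) by (cases m) auto
  have fin: "finite S" unfolding S by (rule finite_subset[of _ "{0..int p}"]) auto
  have root: "[a ^ m = 1] (mod int p)" if "a \<in> S" for a
    using that assms(1,2) power_residue_power_cong_1 by (auto simp: S)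
  \<comment> \<open>As \<open>a ^ m\<close> is 1, this is the inverse of \<open>a\<close> modulo
    \<open>p\<close>, reduced to the range of \<open>S\<close>. It permutes \<open>S\<close>, so the
    squared product is the product of all \<open>a * f a\<close>.\<close>
  define f where "f a = a ^ (m - 1) mod int p" for a :: int
  have fc: "[f a = a ^ (m - 1)] (mod int p)" for a by (simp add: f_def cong_def)
  have af: "[a * f a = 1] (mod int p)" if "a \<in> S" for a
    using cong_trans[OF cong_scalar_left[OF fc[of a], of a]] root[OF that] m0
    by (metis power_eq_if not_gr_zero)
  have fS: "f a \<in> S" if a: "a \<in> S" for a
  proof -
    have nd: "\<not> int p dvd f a"
    proof
      assume "int p dvd f a"
      hence "int p dvd 1" using af[OF a] by (metis cong_dvd_iff dvd_mult)
      thus False using assms(1) by (auto simp: prime_nat_iff)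
    qed
    obtain x where "[a = x ^ k] (mod int p)"
      using a by (auto simp: S power_residue_def)
    hence "[f a = (x ^ k) ^ (m - 1)] (mod int p)"
      using fc cong_pow cong_trans by blast
    hence "[f a = (x ^ (m - 1)) ^ k] (mod int p)"
      by (simp add: mult.commute flip: power_mult)
    hence "power_residue p k (f a)" using nd unfolding power_residue_def by blast
    moreover have "f a \<ge> 0" "f a < int p" using p0 by (auto simp: f_def)
    moreover have "f a \<noteq> 0" using nd by auto
    ultimately show ?thesis by (auto simp: S)
  qed
  have "inj_on f S"
  proof (rule inj_onI)
    fix a b assume ab: "a \<in> S" "b \<in> S" "f a = f b"
    \<comment> \<open>If \<open>f a = f b\<close>, the same product \<open>a * b * f a\<close> is
      congruent to both \<open>a\<close> and \<open>b\<close>.\<close>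
    have "[a * (b * f b) = a * 1] (mod int p)" using af ab(2) cong_scalar_left by blast
    moreover have "[b * (a * f a) = b * 1] (mod int p)" using af ab(1) cong_scalar_left by blast
    moreover have "a * (b * f b) = b * (a * f a)" using ab(3) by simp
    ultimately have "[a = b] (mod int p)" by (metis cong_sym cong_trans mult.right_neutral)
    thus "a = b" using ab(1,2) by (auto simp: S cong_def)
  qed
  moreover have "f ` S \<subseteq> S" using fS by blast
  ultimately have "bij_betw f S S"
    using fin by (simp add: bij_betw_def endo_inj_surj)
  hence "\<Prod>S = (\<Prod>a\<in>S. f a)" using prod.reindex_bij_betw[of f S S "\<lambda>x. x"] by simp
  hence "(\<Prod>S) ^ 2 = (\<Prod>a\<in>S. a * f a)" by (simp add: prod.distrib power2_eq_square)
  also have "[(\<Prod>a\<in>S. a * f a) = (\<Prod>a\<in>S. 1)] (mod int p)" by (intro cong_prod af)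
  finally show ?thesis by simp
qed

theorem theorem1p5:
  fixes p k m :: nat and \<alpha> :: "nat \<Rightarrow> int"
  assumes "prime p" and "odd p"
    and "k \<ge> 2" and "even k" and "k dvd p - 1" and "p = k * m + 1"
    and "\<not> power_residue p k (- 1)"
    and "strict_mono_on {1..m} \<alpha>"
    and "\<alpha> ` {1..m} = {a. 0 < a \<and> a < int p \<and> power_residue p k a}"
  shows "rat_cong p (det (I_mat m \<alpha>)) ((- 1) ^ ((m + 1) div 2) / (2 * of_nat k) ^ m)"
proof -
  have "odd m" using power_residue_minus_one assms(1,2,6,7) by blast
  define S where "S = {a. 0 < a \<and> a < int p \<and> power_residue p k a}"
  \<comment> \<open>Shifts the index range from \<open>{1..m}\<close> to \<open>{..<m}\<close>, as
    matrices require.\<close>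
  define a where "a i = \<alpha> (i + 1)" for i
  have inj\<alpha>: "inj_on \<alpha> {1..m}" using assms(8) by (rule strict_mono_on_imp_inj_on)
  have bij: "bij_betw a {..<m} S"
  proof -
    have "bij_betw (\<lambda>i. i + 1) {..<m} {1..m}"
      by (rule bij_betw_byWitness[where f' = "\<lambda>i. i - 1"]) auto
    moreover have "bij_betw \<alpha> {1..m} S" using inj\<alpha> assms(9) by (simp add: bij_betw_def S_def)
    ultimately have "bij_betw (\<alpha> \<circ> (\<lambda>i. i + 1)) {..<m} S" by (rule bij_betw_trans)
    thus ?thesis by (simp add: a_def[abs_def] comp_def)
  qed
  have aS: "a i \<in> S" if "i < m" for i using bij that by (auto simp: bij_betw_def)
  have inj: "i = j" if "i < m" "j < m" "[a i = a j] (mod int p)" for i j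
  proof -
    have "a i = a j" using that aS[of i] aS[of j] by (auto simp: S_def cong_def)
    thus ?thesis using bij that by (auto simp: bij_betw_def inj_on_def)
  qed
  have root: "[a i ^ m = 1] (mod int p)" if "i < m" for i
    using aS[OF that] power_residue_power_cong_1 assms(1,6) by (auto simp: S_def)
  have "[(\<Prod>S) ^ 2 = 1] (mod int p)"
    using prod_power_residues_square_cong[OF assms(1,6) S_def] .
  moreover have "(\<Prod>i<m. a i) = \<Prod>S" using prod.reindex_bij_betw[OF bij, of "\<lambda>x. x"] by simp
  ultimately have "[((\<Prod>i<m. a i) ^ 2) ^ (m div 2) = 1 ^ (m div 2)] (mod int p)"
    by (intro cong_pow) simp
  \<comment> \<open>The exponent \<open>m - 1\<close> is even, so knowing the square of the product
    suffices.\<close>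
  moreover have "2 * (m div 2) = m - 1" using \<open>odd m\<close> by presburger
  ultimately have P: "[(\<Prod>i<m. a i) ^ (m - 1) = 1] (mod int p)"
    by (simp flip: power_mult)
  have "[int (k * m) = - 1] (mod int p)"
    using assms(6) by (simp add: cong_iff_dvd_diff add.commute)
  hence "[int (k * m) ^ m = (- 1) ^ m] (mod int p)" by (rule cong_pow)
  from cong_mult[OF cong_refl cong_mult[OF this P], of "(- 1) ^ (m div 2)"]
  have "[int k ^ m * ((- 1) ^ (m div 2) * int m ^ m * (\<Prod>i<m. a i) ^ (m - 1)) =
      (- 1) ^ (m div 2 + m)] (mod int p)"
    by (simp add: power_mult_distrib power_add mult_ac)
  \<comment> \<open>For m = 2n+1 the exponents are 3n+1 and n+1, which have equal parity.\<close>
  moreover have "(- 1 :: int) ^ (m div 2 + m) = (- 1) ^ ((m + 1) div 2)"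
    using \<open>odd m\<close> by (auto elim!: oddE simp: power_add)
  ultimately have final: "[int k ^ m * ((- 1) ^ (m div 2) * int m ^ m * (\<Prod>i<m. a i) ^ (m - 1)) =
      (- 1) ^ ((m + 1) div 2)] (mod int p)" by simp

  have I: "I_mat m \<alpha> = mat m m (\<lambda>(i, j). 1 / (of_int (a i) + of_int (a j)))"
    by (simp add: I_mat_def a_def)
  have "rat_cong p (2 ^ m * det (I_mat m \<alpha>))
      (of_int ((- 1) ^ (m div 2) * int m ^ m * (\<Prod>i<m. a i) ^ (m - 1)))"
    unfolding I by (rule rat_cong_det_inverse_sum_roots_of_unity[OF assms(1,2) \<open>odd m\<close> root inj])
  from rat_cong_mult[OF rat_cong_of_int[OF cong_refl] this, of "int k ^ m"]
  have "rat_cong p (of_int (int (2 * k) ^ m) * det (I_mat m \<alpha>))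
      (of_int (int k ^ m * ((- 1) ^ (m div 2) * int m ^ m * (\<Prod>i<m. a i) ^ (m - 1))))"
    by (simp add: power_mult_distrib mult_ac)
  also have "rat_cong p \<dots> (of_int ((- 1) ^ ((m + 1) div 2)))"
    using final by (rule rat_cong_of_int)
  finally have *: "rat_cong p (of_int (int (2 * k) ^ m) * det (I_mat m \<alpha>))
      (of_int ((- 1) ^ ((m + 1) div 2)))" .
  \<comment> \<open>A common divisor of \<open>k\<close> and \<open>k * m + 1\<close> divides
    1.\<close>
  have "coprime k p"
    using assms(6) by (metis coprime_Suc_right_nat coprime_mult_right_iff coprime_commute
        coprime_mult_left_iff Suc_eq_plus1)
  moreover have "coprime 2 p" using assms(2) by simp
  ultimately have "coprime (int (2 * k)) (int p)" by (simp only: coprime_int_iff coprime_mult_left_iff)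
  hence "coprime (int (2 * k) ^ m) (int p)" by simp
  moreover have "int (2 * k) ^ m \<noteq> 0" using assms(3) by simp
  ultimately show ?thesis using rat_cong_divide_of_int[OF _ _ *] by simp
qed

end
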